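(* Let $F$ be a field with $\operatorname{char}(F)\neq 2,3$, let $K/F$ be a quadratic étale extension with non-trivial Galois automorphism $\sigma$, and let $\mathcal{K}=(J,N,\sharp,T)$ be a hermitian cubic norm structure over $K/F$. Let $z\in J$ be an arbitrary element with $N(z)$ invertible in $K$, and write $\gamma:=N(z)^\sigma$. Define maps $\hat N\colon J\to K$, $\hat\sharp\colon J\to J$, $\hat\times\colon J\times J\to J$ and $\hat T\colon J\times J\to K$ by $$\hat N(a):=\gamma N(a),\qquad a^{\hat\sharp}:=\gamma^{-1}\,U_z(a)^\sharp,\qquad a\mathbin{\hat\times}b:=\gamma^{-1}\,(U_z(a)\times U_z(b)),\qquad \hat T(a,b):=T(a,U_z(b))$$ for all $a,b\in J$, and define $\hat 1:=\gamma^{-1}z^\sharp\in J$. Then $\mathcal{J}:=(J,\hat N,\hat\sharp,\hat T,\hat 1)$ is a cubic norm structure over $K$, and the map $\varphi:=U_z^{-1}$ is a $\sigma$-semilinear self-adjoint element of the structure group $\operatorname{Str}(\mathcal{J})$ of $\mathcal{J}$. Moreover, if we set $\delta:=\hat N(\varphi(\hat 1))$, then $\gamma^{\sigma+1}=\delta^{-1}$.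
   Context: **Conventions.** A quadratic étale extension $K/F$ is either a separable quadratic field extension or the split algebra $F\oplus F$ (with $\sigma$ the exchange map). For $t\in K$ write $t^\sigma=\sigma(t)$, $t^{\sigma+1}=t^\sigma t$, $t^{2\sigma}=(t^\sigma)^2$. **Hermitian cubic norm structure.** A hermitian (non-unital) cubic norm structure over $K/F$ is a quadruple $(J,N,\sharp,T)$, where $J$ is a left $K$-module, $N\colon J\to K$ is a non-zero map, $\sharp\colon J\to J$, $a\mapsto a^\sharp$, is a map, and $T\colon J\times J\to K$ is a hermitian form (biadditive, $T(sa,tb)=st^\sigma T(a,b)$ and $T(a,b)^\sigma=T(b,a)$), such that with $a\times b:=(a+b)^\sharp-a^\sharp-b^\sharp$, for all $t\in K$, $a,b\in J$: (i) $(ta)^\sharp=t^{2\sigma}a^\sharp$; (ii) $N(ta)=t^3N(a)$; (iii) $N(a+b)=N(a)+T(b,a^\sharp)+T(a,b^\sharp)+N(b)$; (iv) $a^{\sharp\sharp}=N(a)a$. Its $U$-operators are $U_a(b):=T(a,b)a-a^\sharp\times b$ (these are the operators $U_z$ in the claim). **Cubic norm structure.** A cubic norm structure over $K$ is a quintuple $(J,N,\sharp,T,1)$, where $J$ is a left $K$-module, $N\colon J\to K$, $\sharp\colon J\to J$ are maps, $T\colon J\times J\to K$ is a symmetric $K$-bilinear form and $1\in J\setminus\{0\}$, such that with $a\times b:=(a+b)^\sharp-a^\sharp-b^\sharp$, for all $t\in K$, $a,b\in J$: (i) $(ta)^\sharp=t^2a^\sharp$; (ii) $N(ta)=t^3N(a)$;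 (iii) $N(a+b)=N(a)+T(b,a^\sharp)+T(a,b^\sharp)+N(b)$; (iv) $a^{\sharp\sharp}=N(a)a$; (v) $1^\sharp=1$; (vi) $b=T(b,1)1-1\times b$. Its $U$-operators are likewise $U_a(b):=T(a,b)a-a^\sharp\times b$. An element $a$ is invertible if $N(a)$ is invertible in $K$. **Autotopies of a cubic norm structure $(J,N,\sharp,T,1)$.** For invertible $w\in J$, put $a^{\sharp_w}:=N(w)^{-1}U_w(a^\sharp)$. A map $\varphi\colon J\to J$ is $\sigma$-semilinear if it is additive and $\varphi(ta)=t^\sigma\varphi(a)$. A $\sigma$-semilinear bijection $\varphi$ such that $w:=\varphi(1)$ is invertible is an autotopy if $\varphi(a^\sharp)=\varphi(a)^{\sharp_w}$ for all $a\in J$. The structure group $\operatorname{Str}$ is the group of all autotopies (over all $\sigma\in\operatorname{Aut}(K)$). The adjoint of $\varphi$ is $\check\varphi:=\varphi^{-1}U_w$, and $\varphi$ is self-adjoint if $\check\varphi=\varphi$. (For the structure $\mathcal{J}$ in the claim, all of these are formed with $\hat N,\hat\sharp,\hat T,\hat 1$ and its own $U$-operators.)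
   Formalization: The map ♯ is assumed quadratic, i.e. × is biadditive and σ-semilinear in each argument (also proved, K-bilinear, for the new structure); without this the claim can fail when T is degenerate, since U_z need not be additive. *)

theory Defs
  imports "HOL-Computational_Algebra.Polynomial"
begin

section \<open>Quadratic etale extensions\<close>

definition is_ring_hom :: "('a::comm_ring_1 \<Rightarrow> 'b::comm_ring_1) \<Rightarrow> bool" where
  "is_ring_hom h \<longleftrightarrow>
     h 1 = 1 \<and> (\<forall>x y. h (x + y) = h x + h y) \<and> (\<forall>x y. h (x * y) = h x * h y)"

definition is_ring_aut :: "('a::comm_ring_1 \<Rightarrow> 'a) \<Rightarrow> bool" where
  "is_ring_aut h \<longleftrightarrow> is_ring_hom h \<and> bij h"

text \<open>
  The extension \<open>K/F\<close> is given by its structure map \<open>\<iota>\<close> from \<open>F\<close> to \<open>K\<close>; \<open>K\<close> is only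
  a commutative ring, because it may be \<open>F \<oplus> F\<close>. An element of \<open>K\<close> is separable over \<open>F\<close>
  if it is a root of a non-zero polynomial over \<open>F\<close> that is coprime to its derivative.
\<close>

definition separable_quadratic_field_ext :: "('f::field \<Rightarrow> 'k::comm_ring_1) \<Rightarrow> bool" where
  "separable_quadratic_field_ext \<iota> \<longleftrightarrow>
     is_ring_hom \<iota> \<and>
     (\<forall>x::'k. x \<noteq> 0 \<longrightarrow> x dvd 1) \<and>
     vector_space.dim (\<lambda>c x. \<iota> c * x) UNIV = 2 \<and>
     (\<forall>x. \<exists>p::'f poly. p \<noteq> 0 \<and> coprime p (pderiv p) \<and> poly (map_poly \<iota> p) x = 0)"

text \<open>
  An isomorphism of \<open>F\<close>-algebras from \<open>K\<close> to \<open>F \<oplus> F\<close> is given by its two coordinate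
  functions \<open>p\<close> and \<open>q\<close>; under it, \<open>\<sigma>\<close> becomes the exchange map.
\<close>

definition split_quadratic :: "('f::field \<Rightarrow> 'k::comm_ring_1) \<Rightarrow> ('k \<Rightarrow> 'k) \<Rightarrow> bool" where
  "split_quadratic \<iota> \<sigma> \<longleftrightarrow>
     (\<exists>p q. is_ring_hom p \<and> is_ring_hom q \<and> bij (\<lambda>x. (p x, q x)) \<and>
        (\<forall>c. p (\<iota> c) = c \<and> q (\<iota> c) = c) \<and>
        (\<forall>x. p (\<sigma> x) = q x \<and> q (\<sigma> x) = p x))"

locale quadratic_etale =
  fixes \<iota> :: "'f::field \<Rightarrow> 'k::comm_ring_1"
    and \<sigma> :: "'k \<Rightarrow> 'k"
  assumes quadratic_etale:
    "(separable_quadratic_field_ext \<iota> \<and> is_ring_aut \<sigma> \<and> (\<forall>c. \<sigma> (\<iota> c) = \<iota> c) \<and> \<sigma> \<noteq> id)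
     \<or> split_quadratic \<iota> \<sigma>"

text \<open>The inverse of a unit; the value is unspecified on non-units.\<close>

definition unit_inv :: "'k::comm_ring_1 \<Rightarrow> 'k" where
  "unit_inv x = (THE y. x * y = 1)"


section \<open>Cubic norm structures and their hermitian versions\<close>

definition cross :: "('j::ab_group_add \<Rightarrow> 'j) \<Rightarrow> 'j \<Rightarrow> 'j \<Rightarrow> 'j" where
  "cross sharp a b = sharp (a + b) - sharp a - sharp b"

definition Uop ::
  "('k::comm_ring_1 \<Rightarrow> 'j::ab_group_add \<Rightarrow> 'j) \<Rightarrow> ('j \<Rightarrow> 'j) \<Rightarrow> ('j \<Rightarrow> 'j \<Rightarrow> 'k) \<Rightarrow> 'j \<Rightarrow> 'j \<Rightarrow> 'j"
where
  "Uop scale sharp T a b = scale (T a b) a - cross sharp (sharp a) b"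

text \<open>
  In both structures below, \<open>\<sharp>\<close> is understood to be a quadratic map: besides the scaling
  rule for \<open>\<sharp>\<close>, its linearization \<open>\<times>\<close> is biadditive, and semilinear (with respect to
  \<open>\<sigma>\<close>) in the hermitian case and linear in the other one. Since \<open>\<times>\<close> is symmetric by
  construction, it suffices to say this for one argument. It does not follow from the
  remaining axioms when \<open>T\<close> is degenerate, and without it \<open>U\<^sub>z\<close> need not be semilinear.
\<close>

locale hermitian_cubic_norm_structure =
  quadratic_etale \<iota> \<sigma> + module scale
  for \<iota> :: "'f::field \<Rightarrow> 'k::comm_ring_1"
    and \<sigma> :: "'k \<Rightarrow> 'k"
    and scale :: "'k \<Rightarrow> 'j::ab_group_add \<Rightarrow> 'j"
    and N :: "'j \<Rightarrow> 'k"
    and sharp :: "'j \<Rightarrow> 'j"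
    and T :: "'j \<Rightarrow> 'j \<Rightarrow> 'k" +
  assumes N_nonzero: "\<exists>a. N a \<noteq> 0"
    and T_add_left: "T (a + b) c = T a c + T b c"
    and T_add_right: "T a (b + c) = T a b + T a c"
    and T_scale: "T (scale s a) (scale t b) = s * \<sigma> t * T a b"
    and T_hermitian: "\<sigma> (T a b) = T b a"
    and cross_add: "cross sharp (a + b) c = cross sharp a c + cross sharp b c"
    and cross_scale: "cross sharp (scale t a) b = scale (\<sigma> t) (cross sharp a b)"
    and sharp_scale: "sharp (scale t a) = scale ((\<sigma> t)^2) (sharp a)"
    and N_scale: "N (scale t a) = t^3 * N a"
    and N_add: "N (a + b) = N a + T b (sharp a) + T a (sharp b) + N b"
    and sharp_sharp: "sharp (sharp a) = scale (N a) a"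

locale cubic_norm_structure =
  module scale
  for scale :: "'k::comm_ring_1 \<Rightarrow> 'j::ab_group_add \<Rightarrow> 'j"
    and N :: "'j \<Rightarrow> 'k"
    and sharp :: "'j \<Rightarrow> 'j"
    and T :: "'j \<Rightarrow> 'j \<Rightarrow> 'k"
    and e :: 'j +
  assumes e_nonzero: "e \<noteq> 0"
    and T_add: "T (a + b) c = T a c + T b c"
    and T_scale: "T (scale t a) b = t * T a b"
    and T_sym: "T a b = T b a"
    and cross_add: "cross sharp (a + b) c = cross sharp a c + cross sharp b c"
    and cross_scale: "cross sharp (scale t a) b = scale t (cross sharp a b)"
    and sharp_scale: "sharp (scale t a) = scale (t^2) (sharp a)"
    and N_scale: "N (scale t a) = t^3 * N a"
    and N_add: "N (a + b) = N a + T b (sharp a) + T a (sharp b) + N b"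
    and sharp_sharp: "sharp (sharp a) = scale (N a) a"
    and sharp_e: "sharp e = e"
    and e_cross: "b = scale (T b e) e - cross sharp e b"


section \<open>Autotopies\<close>

definition semilinear ::
  "('k::comm_ring_1 \<Rightarrow> 'j::ab_group_add \<Rightarrow> 'j) \<Rightarrow> ('k \<Rightarrow> 'k) \<Rightarrow> ('j \<Rightarrow> 'j) \<Rightarrow> bool" where
  "semilinear scale \<tau> \<phi> \<longleftrightarrow>
     (\<forall>a b. \<phi> (a + b) = \<phi> a + \<phi> b) \<and> (\<forall>t a. \<phi> (scale t a) = scale (\<tau> t) (\<phi> a))"

definition isotope_sharp ::
  "('k::comm_ring_1 \<Rightarrow> 'j::ab_group_add \<Rightarrow> 'j) \<Rightarrow> ('j \<Rightarrow> 'k) \<Rightarrow> ('j \<Rightarrow> 'j) \<Rightarrow>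
   ('j \<Rightarrow> 'j \<Rightarrow> 'k) \<Rightarrow> 'j \<Rightarrow> 'j \<Rightarrow> 'j" where
  "isotope_sharp scale N sharp T w a =
     scale (unit_inv (N w)) (Uop scale sharp T w (sharp a))"

definition autotopy ::
  "('k::comm_ring_1 \<Rightarrow> 'j::ab_group_add \<Rightarrow> 'j) \<Rightarrow> ('j \<Rightarrow> 'k) \<Rightarrow> ('j \<Rightarrow> 'j) \<Rightarrow>
   ('j \<Rightarrow> 'j \<Rightarrow> 'k) \<Rightarrow> 'j \<Rightarrow> ('k \<Rightarrow> 'k) \<Rightarrow> ('j \<Rightarrow> 'j) \<Rightarrow> bool" where
  "autotopy scale N sharp T e \<tau> \<phi> \<longleftrightarrow>
     semilinear scale \<tau> \<phi> \<and> bij \<phi> \<and> N (\<phi> e) dvd 1 \<and>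
     (\<forall>a. \<phi> (sharp a) = isotope_sharp scale N sharp T (\<phi> e) (\<phi> a))"

text \<open>The structure group, as the set of its elements; the group operation is composition.\<close>

definition Str ::
  "('k::comm_ring_1 \<Rightarrow> 'j::ab_group_add \<Rightarrow> 'j) \<Rightarrow> ('j \<Rightarrow> 'k) \<Rightarrow> ('j \<Rightarrow> 'j) \<Rightarrow>
   ('j \<Rightarrow> 'j \<Rightarrow> 'k) \<Rightarrow> 'j \<Rightarrow> ('j \<Rightarrow> 'j) set" where
  "Str scale N sharp T e = {\<phi>. \<exists>\<tau>. is_ring_aut \<tau> \<and> autotopy scale N sharp T e \<tau> \<phi>}"

definition adjoint_map ::
  "('k::comm_ring_1 \<Rightarrow> 'j::ab_group_add \<Rightarrow> 'j) \<Rightarrow> ('j \<Rightarrow> 'j) \<Rightarrow>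
   ('j \<Rightarrow> 'j \<Rightarrow> 'k) \<Rightarrow> 'j \<Rightarrow> ('j \<Rightarrow> 'j) \<Rightarrow> 'j \<Rightarrow> 'j" where
  "adjoint_map scale sharp T e \<phi> = inv \<phi> \<circ> Uop scale sharp T (\<phi> e)"

end

theory Submission
  imports Defs
begin

text \<open>
  A hermitian cubic norm structure behaves like a cubic Jordan pair whose two halves are \<open>J\<close>
  and its conjugate, with \<open>\<sharp>\<close> going back and forth between them; the element \<open>z\<close> of
  invertible norm identifies the halves by \<open>U\<^sub>z\<close>, and the theorem describes the resulting
  cubic Jordan algebra. In it, \<open>U\<close>-operators are computed by
  \<open>U\<^sub>a U\<^sub>z\<close> (\<open>Uop_hat\<close>).

  Everything rests on the adjoint identity \<open>a\<^sup>\<sharp>\<^sup>\<sharp> = N(a) a\<close>. Replacing \<open>a\<close> by \<open>a + t b\<close>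
  turns both sides into polynomials in \<open>t\<close>, and since 2 and 3 are units, the values at
  \<open>1\<close>, \<open>-1\<close> and \<open>2\<close> suffice to compare coefficients
  (\<open>linearized_adjoint_identities\<close>). They are obtained in \<open>J\<close> itself, not by
  pairing with \<open>T\<close>, which may be degenerate. With \<open>\<gamma> = N(z)\<^sup>\<sigma>\<close>, they yield
  the following facts.

    \<^item> \<open>U\<^sub>z\<close> has, up to a unit scalar, the inverse \<open>U\<^sub>w\<close> with \<open>w = z\<^sup>\<sharp>\<close>
      (\<open>U_sharp_U\<close>, \<open>U_U_sharp\<close>), and \<open>U\<^sub>z(a)\<^sup>\<sharp> = U\<^sub>w(a\<^sup>\<sharp>)\<close> (\<open>sharp_U\<close>).
    \<^item> Hence \<open>U\<^sub>z\<close> sends \<open>\<gamma>\<^sup>-\<^sup>1 U\<^sub>z(a)\<^sup>\<sharp>\<close>, which is the new \<open>\<sharp>\<close> of \<open>a\<close>, to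
      \<open>N(z) a\<^sup>\<sharp>\<close>, and the new unit element to \<open>z\<close> (\<open>U_hat_sharp\<close>, \<open>U_hat_1\<close>). With
      these two formulas every axiom of a cubic norm structure becomes a short computation.
    \<^item> The linearization of \<open>sharp_U\<close> gives the fundamental formula
      \<open>U\<^sub>v = U\<^sub>z U\<^sub>y U\<^sub>z\<close> for \<open>v = U\<^sub>z(y)\<close>. Applied to the image \<open>y\<close> of the new unit under
      \<open>\<phi> = U\<^sub>z\<^sup>-\<^sup>1\<close>, it says that the new \<open>U\<close>-operator of that image is \<open>\<phi>\<^sup>2\<close>
      (\<open>Uop_hat_\<phi>_hat_1\<close>). This is self-adjointness, and it reduces the autotopy
      condition to a comparison of scalars. The scalar in question is \<open>\<delta>\<close>, which is
      determined by \<open>N(U\<^sub>z(a)) = N(z)\<^sup>2 N(a)\<^sup>\<sigma>\<close> (\<open>N_U\<close>).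
\<close>

section \<open>Units and quadratic etale extensions\<close>

lemma unit_inv_eq:
  assumes "x * y = 1"
  shows "unit_inv x = y"
  unfolding unit_inv_def
proof (rule the_equality)
  show "y' = y" if "x * y' = 1" for y'
    using assms that by (metis mult.assoc mult.commute mult_1)
qed (fact assms)

lemma mult_unit_inv:
  assumes "x dvd 1"
  shows "x * unit_inv x = 1"
proof -
  obtain y where "1 = x * y" using assms by (rule dvdE)
  then show ?thesis by (simp add: unit_inv_eq)
qed

lemma mult_left_cancel_unit:
  fixes x y c :: "'k::comm_ring_1"
  assumes "c dvd 1" "c * x = c * y"
  shows "x = y"
  by (metis assms mult.assoc mult.commute mult_1 mult_unit_inv)

lemma unit_mult:
  fixes x y :: "'k::comm_ring_1"
  assumes "x dvd 1" "y dvd 1"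
  shows "x * y dvd 1"
  using mult_dvd_mono[OF assms] by simp

lemma of_nat_prime_ne_0:
  assumes "prime p" "CHAR('f::field) \<noteq> p"
  shows "(of_nat p :: 'f) \<noteq> 0"
proof
  assume "(of_nat p :: 'f) = 0"
  then have "CHAR('f) dvd p" by (simp add: of_nat_eq_0_iff_char_dvd)
  then have "CHAR('f) = 1" using assms by (auto simp: prime_nat_iff)
  then show False by simp
qed

lemma is_ring_hom_of_nat:
  assumes "is_ring_hom h"
  shows "h (of_nat n) = of_nat n"
proof (induction n)
  case 0
  have "h (0 + 0) = h 0 + h 0" using assms unfolding is_ring_hom_def by blast
  then show ?case by simp
next
  case (Suc n)
  then show ?case using assms by (simp add: is_ring_hom_def)
qed

context quadratic_etale
begin

text \<open>
  In the split case \<open>\<sigma>\<close> and \<open>\<iota>\<close> are described only through the two coordinates of \<open>K\<close>;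
  these jointly separate points, and the homomorphism laws hold in each of them.
\<close>

lemma ring_hom_\<sigma>: "is_ring_hom \<sigma>"
  using quadratic_etale
proof
  assume "split_quadratic \<iota> \<sigma>"
  then obtain p q :: "'k \<Rightarrow> 'f" where pq: "is_ring_hom p" "is_ring_hom q" "bij (\<lambda>x. (p x, q x))"
    "\<And>x. p (\<sigma> x) = q x" "\<And>x. q (\<sigma> x) = p x"
    unfolding split_quadratic_def by blast
  then have eq: "x = y" if "p x = p y" "q x = q y" for x y
    using that by (metis (no_types, lifting) bij_pointE)
  show ?thesis
    unfolding is_ring_hom_def
    using pq(1,2) by (auto intro!: eq simp: is_ring_hom_def pq(4,5))
qed (simp add: is_ring_aut_def)

lemma ring_hom_\<iota>: "is_ring_hom \<iota>"
  using quadratic_etale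
proof
  assume "split_quadratic \<iota> \<sigma>"
  then obtain p q :: "'k \<Rightarrow> 'f" where pq: "is_ring_hom p" "is_ring_hom q" "bij (\<lambda>x. (p x, q x))"
    "\<And>c. p (\<iota> c) = c" "\<And>c. q (\<iota> c) = c"
    unfolding split_quadratic_def by blast
  then have eq: "x = y" if "p x = p y" "q x = q y" for x y
    using that by (metis (no_types, lifting) bij_pointE)
  show ?thesis
    unfolding is_ring_hom_def
    using pq(1,2) by (auto intro!: eq simp: is_ring_hom_def pq(4,5))
qed (simp add: separable_quadratic_field_ext_def)

lemma \<sigma>_1 [simp]: "\<sigma> 1 = 1"
  and \<sigma>_add: "\<sigma> (x + y) = \<sigma> x + \<sigma> y"
  and \<sigma>_mult: "\<sigma> (x * y) = \<sigma> x * \<sigma> y"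
  using ring_hom_\<sigma> by (simp_all add: is_ring_hom_def)

lemma \<sigma>_of_nat: "\<sigma> (of_nat n) = of_nat n"
  by (rule is_ring_hom_of_nat[OF ring_hom_\<sigma>])

lemma \<sigma>_numeral [simp]: "\<sigma> (numeral n) = numeral n"
  using \<sigma>_of_nat[of "numeral n"] by simp

lemma \<sigma>_0 [simp]: "\<sigma> 0 = 0"
  using \<sigma>_of_nat[of 0] by simp

lemma \<sigma>_minus: "\<sigma> (- x) = - \<sigma> x"
  using \<sigma>_add[of x "- x"] by (simp add: eq_neg_iff_add_eq_0 add.commute)

lemma \<sigma>_power: "\<sigma> (x ^ n) = \<sigma> x ^ n"
  by (induction n) (simp_all add: \<sigma>_mult)

lemma \<sigma>_dvd_1: "\<sigma> x dvd 1" if "x dvd 1"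
  using that by (metis \<sigma>_1 \<sigma>_mult dvd_def)

lemma of_nat_prime_dvd_1:
  assumes "prime p" "CHAR('f) \<noteq> p"
  shows "of_nat p dvd (1 :: 'k)"
proof -
  have "\<iota> (of_nat p * inverse (of_nat p)) = 1"
    using of_nat_prime_ne_0[OF assms] ring_hom_\<iota> by (simp add: is_ring_hom_def)
  then have "of_nat p * \<iota> (inverse (of_nat p)) = 1"
    using ring_hom_\<iota> by (simp add: is_ring_hom_def is_ring_hom_of_nat)
  then show ?thesis by (metis dvd_triv_left)
qed

end

section \<open>Linearized identities\<close>

text \<open>
  The existence of an invertible norm is made part of the locale because it already forces
  \<open>\<sigma>\<close> to be an involution, on which all later scalar computations depend. It is stated
  existentially, rather than for a fixed \<open>z\<close>, so that identities can be used for both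
  \<open>z\<close> and \<open>z\<^sup>\<sharp>\<close>.
\<close>

locale regular_hermitian_cubic_norm_structure =
  hermitian_cubic_norm_structure \<iota> \<sigma> scale N sharp T
  for \<iota> :: "'f::field \<Rightarrow> 'k::comm_ring_1"
    and \<sigma> :: "'k \<Rightarrow> 'k"
    and scale :: "'k \<Rightarrow> 'j::ab_group_add \<Rightarrow> 'j" (infixr "\<cdot>" 75)
    and N :: "'j \<Rightarrow> 'k"
    and sharp :: "'j \<Rightarrow> 'j"
    and T :: "'j \<Rightarrow> 'j \<Rightarrow> 'k" +
  assumes char_not_2: "CHAR('f) \<noteq> 2"
    and char_not_3: "CHAR('f) \<noteq> 3"
    and unit_norm_exists: "\<exists>z. N z dvd 1"
begin

abbreviation cross_J (infixl "\<times>\<^sub>J" 77) where "a \<times>\<^sub>J b \<equiv> cross sharp a b"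
abbreviation U where "U \<equiv> Uop scale sharp T"

lemma unit_2: "2 dvd (1 :: 'k)" and unit_3: "3 dvd (1 :: 'k)"
  using of_nat_prime_dvd_1[of 2] of_nat_prime_dvd_1[of 3] char_not_2 char_not_3
  by simp_all

lemma scale_left_cancel_unit:
  assumes "c dvd 1" "c \<cdot> x = c \<cdot> y"
  shows "x = y"
  by (metis assms mult.commute mult_unit_inv scale_one scale_scale)

lemma T_scale_left: "T (s \<cdot> a) b = s * T a b"
  using T_scale[of s a 1 b] by simp

lemma T_scale_right: "T a (t \<cdot> b) = \<sigma> t * T a b"
  using T_scale[of 1 a t b] by simp

lemma T_minus_right: "T a (- b) = - T a b"
  using T_scale_right[of a "-1" b] by (simp add: \<sigma>_minus)

lemma T_diff_right: "T a (b - c) = T a b - T a c"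
  using T_add_right[of a b "- c"] by (simp add: T_minus_right)

lemma cross_commute: "a \<times>\<^sub>J b = b \<times>\<^sub>J a"
  by (simp add: cross_def add.commute)

lemma sharp_add: "sharp (a + b) = sharp a + a \<times>\<^sub>J b + sharp b"
  by (simp add: cross_def)

lemma cross_add_right: "a \<times>\<^sub>J (b + c) = a \<times>\<^sub>J b + a \<times>\<^sub>J c"
  by (simp add: cross_add cross_commute[of a])

lemma cross_scale_right: "a \<times>\<^sub>J (t \<cdot> b) = \<sigma> t \<cdot> (a \<times>\<^sub>J b)"
  by (simp add: cross_scale cross_commute[of a])

lemma cross_minus: "(- a) \<times>\<^sub>J b = - (a \<times>\<^sub>J b)"
  using cross_scale[of "-1" a b] by (simp add: \<sigma>_minus)

lemma cross_diff: "(a - b) \<times>\<^sub>J c = a \<times>\<^sub>J c - b \<times>\<^sub>J c"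
  using cross_add[of a "- b" c] by (simp add: cross_minus)

lemma cross_diff_right: "c \<times>\<^sub>J (a - b) = c \<times>\<^sub>J a - c \<times>\<^sub>J b"
  by (simp add: cross_diff cross_commute[of c])

lemma sharp_minus: "sharp (- a) = sharp a"
  using sharp_scale[of "-1" a] by (simp add: \<sigma>_minus)

lemma sharp_diff: "sharp (a - b) = sharp a - a \<times>\<^sub>J b + sharp b"
  using sharp_add[of a "- b"] by (simp add: sharp_minus cross_minus cross_commute[of a])

lemma cross_self: "a \<times>\<^sub>J a = 2 \<cdot> sharp a"
proof -
  have "sharp (a + a) = sharp (2 \<cdot> a)"
    using scale_left_distrib[of 1 1 a] by simp
  also have "\<dots> = sharp a + 2 \<cdot> sharp a + sharp a"
    using scale_left_distrib[of 1 "3" "sharp a"] scale_left_distrib[of 1 2 "sharp a"]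
    by (simp add: sharp_scale)
  finally show ?thesis by (simp add: sharp_add)
qed

text \<open>Euler's identity for the cubic form \<open>N\<close>, read off from \<open>N(2a) = 8 N(a)\<close>.\<close>

lemma T_sharp: "T a (sharp a) = 3 * N a"
proof -
  have "2 ^ 3 * N a = N (1 \<cdot> a + 1 \<cdot> a)"
    unfolding N_scale[symmetric] scale_left_distrib[symmetric] by simp
  also have "\<dots> = 2 * N a + 2 * T a (sharp a)"
    by (simp add: N_add)
  finally have "2 * T a (sharp a) = 2 * (3 * N a)"
    by simp
  then show ?thesis
    by (rule mult_left_cancel_unit[OF unit_2])
qed

text \<open>
  Both sides are the part of \<open>N(a + b + c)\<close> that is trilinear in \<open>a\<close>, \<open>b\<close>, \<open>c\<close>,
  obtained by bracketing the sum in two ways.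
\<close>

lemma T_cross_rotate: "T a (b \<times>\<^sub>J c) = T c (a \<times>\<^sub>J b)"
proof -
  have "N (a + (b + c)) = N ((a + b) + c)" by (simp add: add.assoc)
  then show ?thesis
    unfolding N_add sharp_add T_add_left T_add_right by (simp add: algebra_simps)
qed

lemma T_cross_swap: "T a (b \<times>\<^sub>J c) = T b (a \<times>\<^sub>J c)"
  by (metis T_cross_rotate cross_commute)

text \<open>
  The evaluation points \<open>1\<close>, \<open>-1\<close>, \<open>2\<close> have a Vandermonde determinant that involves only
  the primes 2 and 3.
\<close>

lemma coefficients_eq_0:
  assumes "\<And>t. t \<cdot> x + t\<^sup>2 \<cdot> y + t ^ 3 \<cdot> w = 0"
  shows "x = 0" "y = 0"
proof -
  have 1: "x + y + w = 0" using assms[of 1] by simp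
  have m1: "- x + y - w = 0" using assms[of "-1"] by simp
  have "2 \<cdot> y = (x + y + w) + (- x + y - w)"
    using scale_left_distrib[of 1 1 y] by simp
  then show y: "y = 0"
    using 1 m1 by - (rule scale_left_cancel_unit[OF unit_2], simp)
  have w: "w = - x" using 1 y by (simp add: add_eq_0_iff)
  have "2 \<cdot> x - 8 \<cdot> x = 0" using assms[of 2] y w by simp
  then have "2 \<cdot> (3 \<cdot> x) = 0"
    using scale_left_diff_distrib[of 8 2 x] by simp
  then have "3 \<cdot> x = 0"
    by - (rule scale_left_cancel_unit[OF unit_2], simp)
  then show "x = 0"
    by - (rule scale_left_cancel_unit[OF unit_3], simp)
qed

text \<open>
  Hermitian symmetry makes \<open>\<sigma>\<^sup>2\<close> fix all values of \<open>T\<close>, a set that is closed under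
  multiplication by \<open>K\<close> and contains the unit \<open>T(z, z\<^sup>\<sharp>) = 3 N(z)\<close>.
\<close>

lemma \<sigma>_\<sigma> [simp]: "\<sigma> (\<sigma> t) = t"
proof -
  obtain z where z: "N z dvd 1" using unit_norm_exists by blast
  have fix_T: "\<sigma> (\<sigma> (T a b)) = T a b" for a b
    by (simp add: T_hermitian)
  have "T z (sharp z) dvd 1"
    using z unit_3 by (simp add: T_sharp unit_mult)
  moreover have "T z (sharp z) * \<sigma> (\<sigma> t) = T z (sharp z) * t"
    using fix_T[of "t \<cdot> z" "sharp z"] fix_T[of z "sharp z"]
    by (simp add: T_scale_left \<sigma>_mult mult.commute)
  ultimately show ?thesis by (rule mult_left_cancel_unit)
qed

text \<open>
  The coefficients of \<open>t\<close> and of \<open>t\<^sup>2\<close> in the adjoint identity for \<open>a + t b\<close>; the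
  coefficients of \<open>1\<close> and \<open>t\<^sup>4\<close> agree by the adjoint identity for \<open>a\<close> and \<open>b\<close>. As \<open>\<sharp>\<close>
  is conjugate quadratic, applying it twice gives polynomials in \<open>t\<close> itself.
\<close>

lemma linearized_adjoint_identities:
  shows sharp_cross_cross: "sharp a \<times>\<^sub>J (a \<times>\<^sub>J b) = N a \<cdot> b + T b (sharp a) \<cdot> a"
    and sharp_cross: "sharp (a \<times>\<^sub>J b) =
      T b (sharp a) \<cdot> b + T a (sharp b) \<cdot> a - sharp a \<times>\<^sub>J sharp b"
proof -
  define x where "x = sharp a \<times>\<^sub>J (a \<times>\<^sub>J b) - (N a \<cdot> b + T b (sharp a) \<cdot> a)"
  define y where "y = sharp (a \<times>\<^sub>J b) + sharp a \<times>\<^sub>J sharp b - (T b (sharp a) \<cdot> b + T a (sharp b) \<cdot> a)"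
  define w where "w = (a \<times>\<^sub>J b) \<times>\<^sub>J sharp b - (T a (sharp b) \<cdot> b + N b \<cdot> a)"
  have "t \<cdot> x + t\<^sup>2 \<cdot> y + t ^ 3 \<cdot> w = 0" for t
  proof -
    have "sharp (sharp (a + t \<cdot> b)) = N (a + t \<cdot> b) \<cdot> (a + t \<cdot> b)"
      by (rule sharp_sharp)
    moreover have "sharp (sharp (a + t \<cdot> b)) = sharp (sharp a)
        + t \<cdot> (sharp a \<times>\<^sub>J (a \<times>\<^sub>J b))
        + t\<^sup>2 \<cdot> (sharp (a \<times>\<^sub>J b) + sharp a \<times>\<^sub>J sharp b)
        + t ^ 3 \<cdot> ((a \<times>\<^sub>J b) \<times>\<^sub>J sharp b) + t ^ 4 \<cdot> sharp (sharp b)"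
      by (simp add: sharp_add sharp_scale cross_add cross_add_right cross_scale cross_scale_right
          \<sigma>_power \<sigma>_mult scale_right_distrib power_numeral_reduce mult.assoc add_ac)
    moreover have "N (a + t \<cdot> b) \<cdot> (a + t \<cdot> b) = N a \<cdot> a
        + t \<cdot> (N a \<cdot> b + T b (sharp a) \<cdot> a)
        + t\<^sup>2 \<cdot> (T b (sharp a) \<cdot> b + T a (sharp b) \<cdot> a)
        + t ^ 3 \<cdot> (T a (sharp b) \<cdot> b + N b \<cdot> a) + t ^ 4 \<cdot> (N b \<cdot> b)"
      by (simp add: N_add N_scale T_scale_left T_scale_right sharp_scale \<sigma>_power \<sigma>_mult
          scale_left_distrib scale_right_distrib distrib_left power_numeral_reduce mult_ac add_ac)
    ultimately show ?thesis
      by (simp add: x_def y_def w_def sharp_sharp scale_right_diff_distrib algebra_simps)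
  qed
  from coefficients_eq_0[OF this]
  show "sharp a \<times>\<^sub>J (a \<times>\<^sub>J b) = N a \<cdot> b + T b (sharp a) \<cdot> a"
    and "sharp (a \<times>\<^sub>J b) = T b (sharp a) \<cdot> b + T a (sharp b) \<cdot> a - sharp a \<times>\<^sub>J sharp b"
    unfolding x_def y_def by (simp_all add: algebra_simps)
qed

text \<open>
  Three times either side is \<open>T(a\<^sup>\<sharp>, a\<^sup>\<sharp>\<^sup>\<sharp>)\<close>, by Euler's identity for \<open>a\<^sup>\<sharp>\<close> and for \<open>a\<close>.
\<close>

lemma N_sharp: "N (sharp a) = (\<sigma> (N a))\<^sup>2"
proof -
  have "3 * N (sharp a) = \<sigma> (N a) * \<sigma> (T a (sharp a))"
    by (simp add: T_sharp[symmetric] sharp_sharp T_scale_right T_hermitian)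
  also have "\<dots> = 3 * (\<sigma> (N a))\<^sup>2"
    by (simp add: T_sharp \<sigma>_mult power2_eq_square)
  finally show ?thesis by (rule mult_left_cancel_unit[OF unit_3])
qed

section \<open>The operator of an element of invertible norm\<close>

lemma U_eq: "U a b = T a b \<cdot> a - sharp a \<times>\<^sub>J b"
  by (rule Uop_def)

lemma U_add: "U a (b + c) = U a b + U a c"
  by (simp add: U_eq T_add_right cross_add_right scale_left_distrib)

lemma U_scale: "U a (t \<cdot> b) = \<sigma> t \<cdot> U a b"
  by (simp add: U_eq T_scale_right cross_scale_right scale_right_diff_distrib)

lemma U_scale_left: "U (t \<cdot> a) b = t\<^sup>2 \<cdot> U a b"
  by (simp add: U_eq T_scale_left sharp_scale cross_scale scale_right_diff_distrib
      \<sigma>_mult power2_eq_square mult_ac)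

lemma T_U_commute: "T a (U c b) = T b (U c a)"
proof -
  have "T a (U c b) = T b c * T a c - T a (sharp c \<times>\<^sub>J b)" for a b
    by (simp add: U_eq T_diff_right T_scale_right T_hermitian)
  then show ?thesis
    by (metis T_cross_rotate T_cross_swap mult.commute)
qed

lemma T_U_left: "T (U c a) b = T (U c b) a"
  by (metis T_U_commute T_hermitian)

lemma U_sharp: "U a (sharp a) = N a \<cdot> a"
proof -
  have "U a (sharp a) = (3 * N a) \<cdot> a - (2 * N a) \<cdot> a"
    by (simp add: U_eq T_sharp cross_self sharp_sharp)
  also have "\<dots> = N a \<cdot> a" by (simp flip: scale_left_diff_distrib)
  finally show ?thesis .
qed

lemma U_eq_sharp: "U (sharp a) b = T (sharp a) b \<cdot> sharp a - \<sigma> (N a) \<cdot> (a \<times>\<^sub>J b)"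
  by (simp add: U_eq sharp_sharp cross_scale)

text \<open>
  The identities are grouped in two stages, since those of the second stage come from
  using the first ones for \<open>z\<^sup>\<sharp>\<close>, whose norm is again a unit, as well as for \<open>z\<close>.
\<close>

context
  fixes z
  assumes N_unit: "N z dvd 1"
begin

lemma \<sigma>_N_unit: "\<sigma> (N z) dvd 1"
  using N_unit by (rule \<sigma>_dvd_1)

lemma N_sharp_unit: "N (sharp z) dvd 1"
  using \<sigma>_N_unit by (simp add: N_sharp power2_eq_square unit_mult)

text \<open>
  This is \<open>sharp_cross_cross\<close> for \<open>z\<^sup>\<sharp>\<close> with one factor \<open>\<sigma> (N z)\<close> cancelled.
\<close>

lemma cross_sharp_cross: "z \<times>\<^sub>J (sharp z \<times>\<^sub>J b) = \<sigma> (N z) \<cdot> b + T b z \<cdot> sharp z"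
proof (rule scale_left_cancel_unit[OF \<sigma>_N_unit])
  show "\<sigma> (N z) \<cdot> (z \<times>\<^sub>J (sharp z \<times>\<^sub>J b)) = \<sigma> (N z) \<cdot> (\<sigma> (N z) \<cdot> b + T b z \<cdot> sharp z)"
    using sharp_cross_cross[of "sharp z" b]
    by (simp add: sharp_sharp cross_scale N_sharp T_scale_right scale_right_distrib power2_eq_square)
qed

lemma cross_U: "z \<times>\<^sub>J U z b = T b z \<cdot> sharp z - \<sigma> (N z) \<cdot> b"
proof -
  have "z \<times>\<^sub>J U z b = T b z \<cdot> 2 \<cdot> sharp z - (\<sigma> (N z) \<cdot> b + T b z \<cdot> sharp z)"
    unfolding U_eq cross_diff_right cross_scale_right cross_self cross_sharp_cross
    by (simp only: T_hermitian)
  also have "\<dots> = T b z \<cdot> sharp z - \<sigma> (N z) \<cdot> b"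
    using scale_left_distrib[of "T b z" "T b z" "sharp z"]
    by (simp add: mult_2_right algebra_simps)
  finally show ?thesis .
qed

lemma U_sharp_U: "U (sharp z) (U z b) = (\<sigma> (N z))\<^sup>2 \<cdot> b"
proof -
  have "T (sharp z) (U z b) = T b (U z (sharp z))" by (rule T_U_commute)
  also have "\<dots> = \<sigma> (N z) * T b z" by (simp add: U_sharp T_scale_right)
  finally show ?thesis
    by (simp add: U_eq_sharp cross_U scale_right_diff_distrib power2_eq_square)
qed

text \<open>
  The left side is a quadratic expansion in \<open>T(z, a) z\<close> and \<open>z\<^sup>\<sharp> \<times> a\<close>: its mixed
  term is given by \<open>cross_sharp_cross\<close>, its last term by \<open>sharp_cross\<close>, and everything
  except \<open>T(z\<^sup>\<sharp>, a\<^sup>\<sharp>) z\<^sup>\<sharp> - \<sigma>(N(z)) (z \<times> a\<^sup>\<sharp>)\<close> cancels.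
\<close>

lemma sharp_U: "sharp (U z a) = U (sharp z) (sharp a)"
proof -
  have "sharp (U z a) =
      T a z ^ 2 \<cdot> sharp z - T a z \<cdot> (z \<times>\<^sub>J (sharp z \<times>\<^sub>J a)) + sharp (sharp z \<times>\<^sub>J a)"
    by (simp add: U_eq sharp_diff sharp_scale cross_scale T_hermitian)
  also have "sharp (sharp z \<times>\<^sub>J a) =
      (\<sigma> (N z) * T a z) \<cdot> a + T (sharp z) (sharp a) \<cdot> sharp z - \<sigma> (N z) \<cdot> (z \<times>\<^sub>J sharp a)"
    by (simp add: sharp_cross sharp_sharp T_scale_right cross_scale)
  finally show ?thesis
    by (simp add: cross_sharp_cross U_eq_sharp scale_right_distrib power2_eq_square mult.commute)
qed

lemma cross_U_U: "U z a \<times>\<^sub>J U z b = U (sharp z) (a \<times>\<^sub>J b)"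
  using sharp_U[of "a + b"] by (simp add: U_add sharp_add sharp_U)

end

context
  fixes z
  assumes N_unit: "N z dvd 1"
begin

text \<open>
  This is \<open>U_sharp_U\<close> for \<open>z\<^sup>\<sharp>\<close>, because \<open>z\<^sup>\<sharp>\<^sup>\<sharp>\<close> is the scalar multiple \<open>N(z) z\<close>.
\<close>

lemma U_U_sharp: "U z (U (sharp z) b) = (N z)\<^sup>2 \<cdot> b"
proof (rule scale_left_cancel_unit)
  show "(N z)\<^sup>2 dvd 1" using N_unit by (simp add: power2_eq_square unit_mult)
  show "(N z)\<^sup>2 \<cdot> U z (U (sharp z) b) = (N z)\<^sup>2 \<cdot> (N z)\<^sup>2 \<cdot> b"
    using U_sharp_U[OF N_sharp_unit[OF N_unit], of b]
    by (simp add: sharp_sharp U_scale_left N_sharp \<sigma>_mult power2_eq_square mult_ac)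
qed

lemma U_sharp_of_U: "U z (sharp (U z a)) = (N z)\<^sup>2 \<cdot> sharp a"
  by (simp add: sharp_U[OF N_unit] U_U_sharp)

text \<open>
  Euler's identity expresses \<open>3 N(U\<^sub>z(a))\<close> by \<open>T\<close>; moving \<open>U\<^sub>z\<close> to the other argument of
  \<open>T\<close> produces \<open>U_sharp_of_U\<close>.
\<close>

lemma N_U: "N (U z a) = (N z)\<^sup>2 * \<sigma> (N a)"
proof -
  have "3 * N (U z a) = T (U z (sharp (U z a))) a"
    by (simp add: T_sharp[symmetric] T_U_left)
  also have "\<dots> = (N z)\<^sup>2 * \<sigma> (T a (sharp a))"
    by (simp add: U_sharp_of_U T_scale_left T_hermitian)
  also have "\<dots> = 3 * ((N z)\<^sup>2 * \<sigma> (N a))" by (simp add: T_sharp \<sigma>_mult mult_ac)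
  finally show ?thesis by (rule mult_left_cancel_unit[OF unit_3])
qed

lemma bij_U: "bij (U z)"
proof (rule bijI')
  show "U z x = U z y \<longleftrightarrow> x = y" for x y
  proof
    assume "U z x = U z y"
    then have "(\<sigma> (N z))\<^sup>2 \<cdot> x = (\<sigma> (N z))\<^sup>2 \<cdot> y" by (metis U_sharp_U[OF N_unit])
    moreover have "(\<sigma> (N z))\<^sup>2 dvd 1"
      using \<sigma>_N_unit[OF N_unit] by (simp add: power2_eq_square unit_mult)
    ultimately show "x = y" by (rule scale_left_cancel_unit[rotated])
  qed simp
  show "\<exists>x. y = U z x" for y
  proof
    have "(N z)\<^sup>2 * (unit_inv (N z))\<^sup>2 = 1"
      using mult_unit_inv[OF N_unit] by (simp flip: power_mult_distrib)
    then show "y = U z (U (sharp z) ((\<sigma> (\<sigma> (unit_inv (N z))))\<^sup>2 \<cdot> y))"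
      by (simp add: U_U_sharp)
  qed
qed

text \<open>
  Of the two terms of a \<open>U\<close>-operator, the first is handled by moving \<open>U\<^sub>z\<close> across \<open>T\<close>.
  For the second, \<open>cross_U_U\<close> for \<open>z\<^sup>\<sharp>\<close> computes \<open>U\<^sub>z(y\<^sup>\<sharp> \<times> U\<^sub>z(c))\<close> up to the unit
  \<open>N(z)\<^sup>2\<close>.
\<close>

lemma fundamental_formula: "U (U z y) c = U z (U y (U z c))"
proof -
  have "(N z)\<^sup>2 \<cdot> U z (sharp y \<times>\<^sub>J U z c) = U (sharp z) (sharp y) \<times>\<^sub>J U (sharp z) (U z c)"
    using cross_U_U[OF N_sharp_unit[OF N_unit], of "sharp y" "U z c"]
    by (simp add: sharp_sharp U_scale_left)
  also have "\<dots> = (N z)\<^sup>2 \<cdot> (sharp (U z y) \<times>\<^sub>J c)"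
    by (simp add: sharp_U[OF N_unit] U_sharp_U[OF N_unit] cross_scale_right \<sigma>_power)
  finally have "U z (sharp y \<times>\<^sub>J U z c) = sharp (U z y) \<times>\<^sub>J c"
    by (rule scale_left_cancel_unit[rotated]) (use N_unit in \<open>simp add: power2_eq_square unit_mult\<close>)
  moreover have "\<sigma> (T y (U z c)) = T (U z y) c"
    by (metis T_U_left T_hermitian)
  moreover have "U z (a - b) = U z a - U z b" for a b
    by (metis U_add add_diff_cancel diff_add_cancel)
  ultimately show ?thesis
    by (simp add: U_eq[of "U z y"] U_eq[of y] U_scale)
qed

section \<open>The cubic norm structure attached to the element\<close>

lemma \<sigma>_unit_inv: "\<sigma> (unit_inv (N z)) = unit_inv (\<sigma> (N z))"
  by (metis N_unit \<sigma>_1 \<sigma>_mult mult_unit_inv unit_inv_eq)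

abbreviation "\<gamma> \<equiv> \<sigma> (N z)"
abbreviation "hat_N \<equiv> \<lambda>a. \<gamma> * N a"
abbreviation "hat_sharp \<equiv> \<lambda>a. unit_inv \<gamma> \<cdot> sharp (U z a)"
abbreviation "hat_T \<equiv> \<lambda>a b. T a (U z b)"
abbreviation "hat_1 \<equiv> unit_inv \<gamma> \<cdot> sharp z"

lemma \<gamma>_unit_inv: "\<gamma> * unit_inv \<gamma> = 1"
  by (rule mult_unit_inv[OF \<sigma>_N_unit[OF N_unit]])

lemma \<sigma>_unit_inv_\<gamma>: "\<sigma> (unit_inv \<gamma>) = unit_inv (N z)"
  by (simp flip: \<sigma>_unit_inv)

text \<open>
  Under \<open>U\<^sub>z\<close>, the new adjoint and the new unit element turn into multiples of \<open>a\<^sup>\<sharp>\<close> and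
  \<open>z\<close>, which removes all nested occurrences of \<open>U\<^sub>z\<close> from the axioms to be checked.
\<close>

lemma U_hat_sharp: "U z (hat_sharp a) = N z \<cdot> sharp a"
proof -
  have "unit_inv (N z) * (N z)\<^sup>2 = (N z * unit_inv (N z)) * N z"
    by (simp add: power2_eq_square mult_ac)
  then show ?thesis
    by (simp add: U_scale \<sigma>_unit_inv_\<gamma> U_sharp_of_U mult_unit_inv[OF N_unit])
qed

lemma U_hat_1: "U z hat_1 = z"
  by (simp add: U_scale \<sigma>_unit_inv_\<gamma> U_sharp mult_unit_inv[OF N_unit] mult.commute)

lemma cross_hat_sharp: "cross hat_sharp a b = unit_inv \<gamma> \<cdot> (U z a \<times>\<^sub>J U z b)"
  by (simp add: cross_def U_add scale_right_diff_distrib)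

lemma Uop_hat: "Uop scale hat_sharp hat_T a b = U a (U z b)"
proof -
  have "unit_inv \<gamma> \<cdot> ((N z \<cdot> sharp a) \<times>\<^sub>J U z b) = sharp a \<times>\<^sub>J U z b"
    using \<gamma>_unit_inv by (simp add: cross_scale mult.commute)
  then show ?thesis
    by (simp add: Uop_def[of scale hat_sharp] cross_hat_sharp U_hat_sharp U_eq[of a])
qed

lemma cubic_norm_structure_hat:
  "cubic_norm_structure scale hat_N hat_sharp hat_T hat_1"
proof
  show "hat_1 \<noteq> 0"
  proof
    \<comment> \<open>If the new unit vanished, so would \<open>z\<close>, its image under \<open>U\<^sub>z\<close>; then \<open>N(z) = 0\<close>
      would be a unit, \<open>K\<close> the zero ring and \<open>N\<close> the zero map.\<close>
    assume "hat_1 = 0"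
    then have "z = 0" using U_hat_1 U_scale[of z 0 0] by simp
    then have "N z = 0" using N_scale[of 0 0] by simp
    then have "(1 :: 'k) = 0" using N_unit by simp
    then have "N a = 0" for a by (metis mult_1 mult_zero_left)
    then show False using N_nonzero by simp
  qed
  show "hat_T (a + b) c = hat_T a c + hat_T b c" for a b c
    by (rule T_add_left)
  show "hat_T (t \<cdot> a) b = t * hat_T a b" for t a b
    by (rule T_scale_left)
  show "hat_T a b = hat_T b a" for a b
    by (rule T_U_commute)
  show "cross hat_sharp (a + b) c = cross hat_sharp a c + cross hat_sharp b c" for a b c
    by (simp add: cross_hat_sharp U_add cross_add scale_right_distrib)
  show "cross hat_sharp (t \<cdot> a) b = t \<cdot> cross hat_sharp a b" for t a b
    by (simp add: cross_hat_sharp U_scale cross_scale mult.commute)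
  show "hat_sharp (t \<cdot> a) = t\<^sup>2 \<cdot> hat_sharp a" for t a
    by (simp add: U_scale sharp_scale mult.commute)
  show "hat_N (t \<cdot> a) = t ^ 3 * hat_N a" for t a
    by (simp add: N_scale mult.left_commute)
  show "hat_N (a + b) = hat_N a + hat_T b (hat_sharp a) + hat_T a (hat_sharp b) + hat_N b"
    for a b
    by (simp add: U_hat_sharp T_scale_right N_add distrib_left)
  show "hat_sharp (hat_sharp a) = hat_N a \<cdot> a" for a
  proof -
    have "hat_sharp (hat_sharp a) = (\<gamma> * unit_inv \<gamma> * \<gamma> * N a) \<cdot> a"
      by (simp only: U_hat_sharp) (simp add: sharp_scale sharp_sharp power2_eq_square mult_ac)
    then show ?thesis by (simp add: \<gamma>_unit_inv)
  qed
  show "hat_sharp hat_1 = hat_1"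
    by (simp only: U_hat_1)
  show "b = hat_T b hat_1 \<cdot> hat_1 - cross hat_sharp hat_1 b" for b
  proof -
    have "cross hat_sharp hat_1 b = T b z \<cdot> hat_1 - (\<gamma> * unit_inv \<gamma>) \<cdot> b"
      unfolding cross_hat_sharp U_hat_1 cross_U[OF N_unit]
      by (simp add: scale_right_diff_distrib mult.commute)
    then show ?thesis by (simp only: U_hat_1) (simp add: \<gamma>_unit_inv)
  qed
qed

section \<open>The inverse operator as a self-adjoint autotopy\<close>

abbreviation "\<phi> \<equiv> inv (U z)"

lemma U_\<phi> [simp]: "U z (\<phi> a) = a"
  using bij_U by (simp add: bij_is_surj surj_f_inv_f)

lemma \<phi>_eqI: "U z a = b \<Longrightarrow> \<phi> b = a"
  using bij_U by (metis bij_inv_eq_iff)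

lemma \<phi>_scale: "\<phi> (t \<cdot> a) = \<sigma> t \<cdot> \<phi> a"
  by (rule \<phi>_eqI) (simp add: U_scale)

lemma semilinear_\<phi>: "semilinear scale \<sigma> \<phi>"
  unfolding semilinear_def by (auto intro: \<phi>_eqI simp: \<phi>_scale U_add)

lemma U_hat_1_left: "U hat_1 b = \<phi> b"
proof (rule \<phi>_eqI[symmetric])
  have "(unit_inv (N z))\<^sup>2 * (N z)\<^sup>2 = 1"
    using mult_unit_inv[OF N_unit] by (simp add: mult.commute flip: power_mult_distrib)
  then show "U z (U hat_1 b) = b"
    by (simp add: U_scale_left U_scale U_U_sharp \<sigma>_power \<sigma>_unit_inv_\<gamma>)
qed

text \<open>
  Write \<open>w\<close> for \<open>\<phi> hat_1\<close>, so that \<open>U\<^sub>z(w)\<close> is \<open>hat_1\<close>. The fundamental formula turns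
  \<open>U\<^sub>z U\<^sub>w U\<^sub>z\<close> into the operator of \<open>hat_1\<close>, a multiple of \<open>z\<^sup>\<sharp>\<close>, and that operator
  is \<open>\<phi>\<close> by \<open>U_hat_1_left\<close>.
\<close>

lemma Uop_hat_\<phi>_hat_1: "Uop scale hat_sharp hat_T (\<phi> hat_1) b = \<phi> (\<phi> b)"
proof -
  have "U z (U (\<phi> hat_1) (U z b)) = \<phi> b"
    by (simp flip: fundamental_formula add: U_hat_1_left)
  then show ?thesis by (simp add: Uop_hat \<phi>_eqI)
qed

text \<open>
  Evaluate \<open>N_U\<close> at \<open>\<phi> hat_1\<close>: its image under \<open>U\<^sub>z\<close> is \<open>\<gamma>\<^sup>-\<^sup>1 z\<^sup>\<sharp>\<close>, whose norm is
  \<open>\<gamma>\<^sup>-\<^sup>3 \<gamma>\<^sup>2\<close>.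
\<close>

lemma hat_N_\<phi>_hat_1: "(\<sigma> \<gamma> * \<gamma>) * hat_N (\<phi> hat_1) = 1"
proof -
  have "\<gamma>\<^sup>2 * N (\<phi> hat_1) = \<sigma> (N (U z (\<phi> hat_1)))"
    by (simp only: N_U) (simp add: \<sigma>_mult \<sigma>_power)
  also have "\<dots> = \<sigma> (unit_inv \<gamma> ^ 3 * \<gamma>\<^sup>2)"
    by (simp add: N_scale N_sharp)
  also have "\<dots> = \<sigma> ((\<gamma> * unit_inv \<gamma>) * (\<gamma> * unit_inv \<gamma>) * unit_inv \<gamma>)"
    by (simp add: power2_eq_square power3_eq_cube mult_ac)
  also have "\<dots> = unit_inv (N z)"
    by (simp add: \<gamma>_unit_inv \<sigma>_unit_inv_\<gamma>)
  finally have "N z * (\<gamma>\<^sup>2 * N (\<phi> hat_1)) = 1"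
    by (simp add: mult_unit_inv[OF N_unit])
  then show ?thesis by (simp add: power2_eq_square mult_ac)
qed

text \<open>
  By \<open>Uop_hat_\<phi>_hat_1\<close>, both sides of the autotopy condition are multiples of
  \<open>\<phi>\<^sup>2(a\<^sup>\<sharp>)\<close>; the scalars agree because the new norm of \<open>\<phi> hat_1\<close> is the inverse of
  \<open>\<sigma>(\<gamma>) \<gamma>\<close>.
\<close>

lemma autotopy_\<phi>: "autotopy scale hat_N hat_sharp hat_T hat_1 \<sigma> \<phi>"
  unfolding autotopy_def
proof (intro conjI allI)
  show "semilinear scale \<sigma> \<phi>" by (rule semilinear_\<phi>)
  show "bij \<phi>" by (rule bij_imp_bij_inv[OF bij_U])
  show "hat_N (\<phi> hat_1) dvd 1"
    using hat_N_\<phi>_hat_1 by (metis dvd_triv_right)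
  have unit_inv_\<delta>: "unit_inv (hat_N (\<phi> hat_1)) = \<sigma> \<gamma> * \<gamma>"
    using hat_N_\<phi>_hat_1 by (intro unit_inv_eq) (simp only: mult.commute)
  show "\<phi> (hat_sharp a) = isotope_sharp scale hat_N hat_sharp hat_T (\<phi> hat_1) (\<phi> a)" for a
  proof -
    have "\<phi> (hat_sharp a) = \<phi> (\<phi> (N z \<cdot> sharp a))"
      using \<phi>_eqI[OF U_hat_sharp] by simp
    also have "\<dots> = (N z * (\<gamma> * unit_inv \<gamma>)) \<cdot> \<phi> (\<phi> (sharp a))"
      by (simp add: \<phi>_scale \<gamma>_unit_inv)
    also have "\<dots> = (\<sigma> \<gamma> * \<gamma>) \<cdot> \<phi> (\<phi> (hat_sharp (\<phi> a)))"
      by (simp add: \<phi>_scale mult_ac)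
    finally show ?thesis
      by (simp add: isotope_sharp_def Uop_hat_\<phi>_hat_1 unit_inv_\<delta>)
  qed
qed

lemma adjoint_map_\<phi>: "adjoint_map scale hat_sharp hat_T hat_1 \<phi> = \<phi>"
  by (simp add: adjoint_map_def fun_eq_iff Uop_hat_\<phi>_hat_1 inv_inv_eq[OF bij_U])

end

end

theorem theorem4p7:
  fixes \<iota> :: "'f::field \<Rightarrow> 'k::comm_ring_1"
    and \<sigma> :: "'k \<Rightarrow> 'k"
    and scale :: "'k \<Rightarrow> 'j::ab_group_add \<Rightarrow> 'j"
    and N :: "'j \<Rightarrow> 'k"
    and sharp :: "'j \<Rightarrow> 'j"
    and T :: "'j \<Rightarrow> 'j \<Rightarrow> 'k"
    and z :: 'j
  assumes "CHAR('f) \<noteq> 2" and "CHAR('f) \<noteq> 3"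
    and "hermitian_cubic_norm_structure \<iota> \<sigma> scale N sharp T"
    and "N z dvd 1"
  defines "U \<equiv> Uop scale sharp T z"
    and "\<gamma> \<equiv> \<sigma> (N z)"
  defines "hN \<equiv> \<lambda>a. \<gamma> * N a"
    and "hsharp \<equiv> \<lambda>a. scale (unit_inv \<gamma>) (sharp (U a))"
    and "hcross \<equiv> \<lambda>a b. scale (unit_inv \<gamma>) (cross sharp (U a) (U b))"
    and "hT \<equiv> \<lambda>a b. T a (U b)"
    and "h1 \<equiv> scale (unit_inv \<gamma>) (sharp z)"
  defines "\<phi> \<equiv> inv U"
  defines "\<delta> \<equiv> hN (\<phi> h1)"
  shows "cubic_norm_structure scale hN hsharp hT h1
    \<and> hcross = cross hsharp
    \<and> bij U
    \<and> semilinear scale \<sigma> \<phi>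
    \<and> \<phi> \<in> Str scale hN hsharp hT h1
    \<and> adjoint_map scale hsharp hT h1 \<phi> = \<phi>
    \<and> \<sigma> \<gamma> * \<gamma> = unit_inv \<delta>"
proof -
  interpret regular_hermitian_cubic_norm_structure \<iota> \<sigma> scale N sharp T
    using assms(1-4)
    by (auto simp: regular_hermitian_cubic_norm_structure_def
        regular_hermitian_cubic_norm_structure_axioms_def)
  note N_unit = \<open>N z dvd 1\<close>
  have "is_ring_aut \<sigma>"
    using ring_hom_\<sigma> by (auto simp: is_ring_aut_def intro: involuntory_imp_bij)
  then have "\<phi> \<in> Str scale hN hsharp hT h1"
    using autotopy_\<phi>[OF N_unit] unfolding assms(5-) Str_def by blast
  moreover have "\<sigma> \<gamma> * \<gamma> = unit_inv \<delta>"
    using hat_N_\<phi>_hat_1[OF N_unit] unfolding assms(5-)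
    by (intro unit_inv_eq[symmetric]) (simp only: mult.commute)
  ultimately show ?thesis
    using cubic_norm_structure_hat[OF N_unit] bij_U[OF N_unit] semilinear_\<phi>[OF N_unit]
      adjoint_map_\<phi>[OF N_unit] cross_hat_sharp[OF N_unit]
    unfolding assms(5-) by (auto simp: fun_eq_iff)
qed

end
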